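(* For every integer $n\ge 1$, $$\mathrm{pf}_n(213,321)=C_n+\sum_{m=1}^{n-1}m\,h_{n,m},$$ where $C_n=\frac{1}{n+1}\binom{2n}{n}$ is the $n$th Catalan number and $h_{n,m}$ is the number of Dyck paths of semilength $n$ in which the $m$th north step is immediately followed by an east step.
   Context: A Dyck path of semilength $n$ is a lattice path from $(0,0)$ to $(n,n)$ consisting of $n$ north steps $N=(0,1)$ and $n$ east steps $E=(1,0)$ that never goes below the line $y=x$. A parking function of size $n$ is a Dyck path of semilength $n$ whose $n$ north steps are labeled bijectively by $\{1,\dots,n\}$ so that whenever two north steps are consecutive in the path (one immediately following the other), the label of the later one is larger. For a parking function $p$ of size $n$, $\phi(p)$ is the permutation of $\{1,\dots,n\}$ (in one-line notation) obtained by reading the labels of the north steps in the order they occur along the path. A permutation $\pi$ of $\{1,\dots,n\}$ contains a permutation $\rho$ of $\{1,\dots,m\}$ if there are indices $1\le i_1<\cdots<i_m\le n$ such that $\pi_{i_a}\le\pi_{i_b}$ if and only if $\rho_a\le\rho_b$; otherwise $\pi$ avoids $\rho$. For permutations $\rho_1,\dots,\rho_r$, $\mathrm{pf}_n(\rho_1,\dots,\rho_r)$ denotes the number of parking functions $p$ of size $n$ such that $\phi(p)$ avoids each of $\rho_1,\dots,\rho_r$. North steps of a path are numbered $1,\dots,n$ in the order they occur along the path. *)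

theory Defs
  imports Complex_Main "HOL-Combinatorics.Multiset_Permutations"
begin

datatype step = North | East

definition dyck_path :: "nat \<Rightarrow> step list \<Rightarrow> bool" where
  "dyck_path n w \<longleftrightarrow>
     count_list w North = n \<and> count_list w East = n \<and>
     (\<forall>k \<le> length w. count_list (take k w) East \<le> count_list (take k w) North)"

(* A labelled path is a pair (w, l), where l ! j is the label of the j-th north step of w,
   counting north steps from 0 in the order in which they occur along w. *)
type_synonym labelled_path = "step list \<times> nat list"

(* The label of the north step at position i of w; only meaningful if w ! i = North. *)
definition label_at :: "labelled_path \<Rightarrow> nat \<Rightarrow> nat" where
  "label_at p i = snd p ! count_list (take i (fst p)) North"

definition parking_function :: "nat \<Rightarrow> labelled_path \<Rightarrow> bool" where
  "parking_function n p \<longleftrightarrow>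
     dyck_path n (fst p) \<and> snd p \<in> permutations_of_set {1..n} \<and>
     (\<forall>i. Suc i < length (fst p) \<and> fst p ! i = North \<and> fst p ! Suc i = North
        \<longrightarrow> label_at p i < label_at p (Suc i))"

(* By the choice of encoding, the second component already lists the labels
   in the order in which the north steps occur. *)
definition \<phi> :: "labelled_path \<Rightarrow> nat list" where
  "\<phi> p = snd p"

definition contains :: "nat list \<Rightarrow> nat list \<Rightarrow> bool" where
  "contains \<pi> \<rho> \<longleftrightarrow>
     (\<exists>f. strict_mono_on {..<length \<rho>} f \<and> f ` {..<length \<rho>} \<subseteq> {..<length \<pi>} \<and>
          (\<forall>a<length \<rho>. \<forall>b<length \<rho>. \<pi> ! f a \<le> \<pi> ! f b \<longleftrightarrow> \<rho> ! a \<le> \<rho> ! b))"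

abbreviation avoids :: "nat list \<Rightarrow> nat list \<Rightarrow> bool" where
  "avoids \<pi> \<rho> \<equiv> \<not> contains \<pi> \<rho>"

definition pf :: "nat \<Rightarrow> nat list set \<Rightarrow> nat" where
  "pf n R = card {p. parking_function n p \<and> (\<forall>\<rho>\<in>R. avoids (\<phi> p) \<rho>)}"

(* Real-valued, so that the division is exact by construction. *)
definition catalan :: "nat \<Rightarrow> real" where
  "catalan n = 1 / (real n + 1) * real ((2 * n) choose n)"

(* Here north steps are numbered from 1. *)
definition north_followed_by_east :: "nat \<Rightarrow> step list \<Rightarrow> bool" where
  "north_followed_by_east m w \<longleftrightarrow>
     (\<exists>i. Suc i < length w \<and> w ! i = North \<and> w ! Suc i = East \<and>
          count_list (take (Suc i) w) North = m)"

definition h :: "nat \<Rightarrow> nat \<Rightarrow> nat" where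
  "h n m = card {w. dyck_path n w \<and> north_followed_by_east m w}"

end

(* A permutation avoiding 213 and 321 is either the identity or has exactly one descent: after a
   descent at position m every entry is smaller than the entry at m (213) and the entries increase
   (321). Moreover no entry before the descent lies strictly between two entries after it, so the
   permutation arises from the identity by swapping two adjacent blocks, and exactly m permutations
   have their descent at position m. A permutation labels a Dyck path to a parking function iff the
   north step at each of its descents is followed by an east step; hence the identity contributes
   all Dyck paths, and each of the m permutations with descent at m contributes h n m of them. *)
theory Submission
  imports Defs
begin

section \<open>Counting Dyck paths\<close>

text \<open>Endpoints off the diagonal are allowed so that deleting the last step stays within the
  family.\<close>

definition ballot_paths :: "nat \<Rightarrow> nat \<Rightarrow> step list set" where
  "ballot_paths a b = {w. count_list w North = a \<and> count_list w East = b \<and>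
     (\<forall>k \<le> length w. count_list (take k w) East \<le> count_list (take k w) North)}"

lemma dyck_path_iff_ballot_paths: "dyck_path n w \<longleftrightarrow> w \<in> ballot_paths n n"
  by (simp add: dyck_path_def ballot_paths_def)

lemma length_eq_count_steps: "length w = count_list w North + count_list w East"
proof (induction w)
  case (Cons a w)
  then show ?case by (cases a) auto
qed simp

lemma finite_ballot_paths: "finite (ballot_paths a b)"
proof (rule finite_subset)
  have "finite (UNIV :: step set)"
    by (rule finite_subset[of _ "{North, East}"]) (use step.exhaust in auto)
  then show "finite {w :: step list. set w \<subseteq> UNIV \<and> length w = a + b}"
    by (rule finite_lists_length_eq)
qed (auto simp: ballot_paths_def length_eq_count_steps)

lemma prefix_condition_snoc:
  "(\<forall>k \<le> length (w @ [s]). count_list (take k (w @ [s])) East \<le> count_list (take k (w @ [s])) North)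
   \<longleftrightarrow> (\<forall>k \<le> length w. count_list (take k w) East \<le> count_list (take k w) North)
     \<and> count_list (w @ [s]) East \<le> count_list (w @ [s]) North"
  by (auto simp: le_Suc_eq)

lemma ballot_paths_snoc_North: "w @ [North] \<in> ballot_paths a b \<longleftrightarrow> a > 0 \<and> w \<in> ballot_paths (a - 1) b"
  unfolding ballot_paths_def mem_Collect_eq prefix_condition_snoc by (auto dest: spec[of _ "length w"])

lemma ballot_paths_snoc_East:
  "w @ [East] \<in> ballot_paths a b \<longleftrightarrow> 0 < b \<and> b \<le> a \<and> w \<in> ballot_paths a (b - 1)"
  unfolding ballot_paths_def mem_Collect_eq prefix_condition_snoc by auto

lemma ballot_paths_eq_empty: "a < b \<Longrightarrow> ballot_paths a b = {}"
  by (auto simp: ballot_paths_def dest: spec[of _ "length _"])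

lemma ballot_paths_0_0: "ballot_paths 0 0 = {[]}"
  by (auto simp: ballot_paths_def simp flip: length_0_conv simp: length_eq_count_steps)

text \<open>Paths are split by their last step. For \<open>a = b\<close> the first set is empty, as
  a last north step would have to start below the diagonal.\<close>

lemma ballot_paths_step:
  assumes "b \<le> a" "0 < a"
  shows "ballot_paths a b = (\<lambda>w. w @ [North]) ` ballot_paths (a - 1) b
     \<union> (if b = 0 then {} else (\<lambda>w. w @ [East]) ` ballot_paths a (b - 1))"
proof (rule set_eqI)
  fix w
  show "w \<in> ballot_paths a b \<longleftrightarrow> w \<in> (\<lambda>w. w @ [North]) ` ballot_paths (a - 1) b
     \<union> (if b = 0 then {} else (\<lambda>w. w @ [East]) ` ballot_paths a (b - 1))"
  proof (cases w rule: rev_cases)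
    case Nil
    then show ?thesis using assms by (auto simp: ballot_paths_def)
  next
    case (snoc v s)
    then show ?thesis using assms
      by (cases s) (auto simp: ballot_paths_snoc_North ballot_paths_snoc_East)
  qed
qed

lemma card_ballot_paths_step:
  assumes "b \<le> a" "0 < a"
  shows "card (ballot_paths a b) =
    card (ballot_paths (a - 1) b) + (if b = 0 then 0 else card (ballot_paths a (b - 1)))"
  unfolding ballot_paths_step[OF assms]
  by (subst card_Un_disjoint) (auto simp: finite_ballot_paths card_image inj_on_def)

(* The range extends to b = a + 1, where both sides vanish, so that the recursion never leaves it. *)
lemma ballot_formula:
  assumes "b \<le> a + 1"
  shows "real (card (ballot_paths a b)) * (real a + 1) = (real a + 1 - real b) * real ((a + b) choose b)"
  using assms
proof (induction "a + b" arbitrary: a b)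
  case 0
  then show ?case by (simp add: ballot_paths_0_0)
next
  case (Suc s)
  show ?case
  proof (cases "b = a + 1")
    case True
    then show ?thesis by (simp add: ballot_paths_eq_empty)
  next
    case False
    then have ba: "b \<le> a" using Suc.prems by simp
    then have "0 < a" using Suc.hyps(2) by simp
    then obtain a' where a: "a = Suc a'" by (cases a) auto
    have 1: "real (card (ballot_paths a' b)) * real a = (real a - real b) * real ((a' + b) choose b)"
      using Suc.hyps(1)[of a' b] Suc.hyps(2) ba a by (simp add: add.commute)
    show ?thesis
    proof (cases b)
      case 0
      then show ?thesis using 1 a card_ballot_paths_step[OF ba \<open>0 < a\<close>] by simp
    next
      case (Suc b')
      define P where "P = real ((a' + b) choose b)"
      define Q where "Q = real ((a' + b) choose b')"
      have 2: "real (card (ballot_paths a b')) * (real a + 1) = (real a + 1 - real b') * Q"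
        using Suc.hyps(1)[of a b'] Suc.hyps(2) ba a Suc by (simp add: Q_def)
      have 3: "real (card (ballot_paths a b)) = real (card (ballot_paths a' b)) + real (card (ballot_paths a b'))"
        using card_ballot_paths_step[OF ba \<open>0 < a\<close>] a Suc by simp
      have 4: "real ((a + b) choose b) = P + Q"
        using a Suc by (simp add: P_def Q_def)
      \<comment> \<open>Both sides equal \<open>(a' + b) * ((a' + b - 1) choose b')\<close>.\<close>
      have "b * ((a' + b) choose b) = a * ((a' + b) choose b')"
        using binomial_absorption[of b' "a' + b"] binomial_absorb_comp[of "a' + b" b'] a Suc by simp
      then have 5: "real b * P = real a * Q"
        unfolding P_def Q_def of_nat_mult[symmetric] by (rule arg_cong)
      have 6: "real b' = real b - 1" using Suc by simp
      \<comment> \<open>The factor \<open>real a\<close> makes fact 1 applicable. The two sides then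
        differ by \<open>real a * Q - real b * P\<close>, which is zero by fact 5.\<close>
      have "real a * (real (card (ballot_paths a b)) * (real a + 1)) =
          real a * ((real a + 1 - real b) * real ((a + b) choose b))"
        using 1 2 5 unfolding 3 4 6 P_def[symmetric] by algebra
      then show ?thesis using \<open>0 < a\<close> by simp
    qed
  qed
qed

lemma card_dyck_paths: "real (card {w. dyck_path n w}) = catalan n"
  using ballot_formula[of n n]
  by (simp add: dyck_path_iff_ballot_paths catalan_def field_simps mult_2 mult_2_right)

section \<open>Parking functions and descents\<close>

lemma ex_nth_occurrence:
  assumes "k < count_list w x"
  shows "\<exists>i < length w. w ! i = x \<and> count_list (take i w) x = k"
  using assms
proof (induction w rule: rev_induct)
  case (snoc y w)
  show ?case
  proof (cases "k < count_list w x")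
    case True
    then obtain i where "i < length w" "w ! i = x" "count_list (take i w) x = k"
      using snoc.IH by auto
    then show ?thesis by (intro exI[of _ i]) (auto simp: nth_append)
  next
    case False
    then have "y = x" "k = count_list w x" using snoc.prems by (auto split: if_splits)
    then show ?thesis by (intro exI[of _ "length w"]) auto
  qed
qed simp

lemma count_list_take_Suc:
  "i < length w \<Longrightarrow> count_list (take (Suc i) w) x = count_list (take i w) x + (if w ! i = x then 1 else 0)"
  by (simp add: take_Suc_conv_app_nth)

lemma count_list_take_mono: "i \<le> j \<Longrightarrow> count_list (take i w) x \<le> count_list (take j w) x"
proof -
  assume "i \<le> j"
  then have "take j w = take i w @ take (j - i) (drop i w)"
    by (metis le_add_diff_inverse take_add)
  then show ?thesis by simp
qed

lemma occurrence_count_less: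
  assumes "i < j" "i < length w" "w ! i = x"
  shows "count_list (take i w) x < count_list (take j w) x"
  using count_list_take_mono[of "Suc i" j w x] count_list_take_Suc[of i w x] assms by simp

text \<open>The number of earlier occurrences grows strictly from one occurrence to the next, so it
  determines the position. Together with \<open>ex_nth_occurrence\<close> this translates between
  numbers of north steps and positions in the path.\<close>

lemma occurrence_unique:
  assumes "i < length w" "w ! i = x" "j < length w" "w ! j = x"
    "count_list (take i w) x = count_list (take j w) x"
  shows "i = j"
  using occurrence_count_less[of i j w x] occurrence_count_less[of j i w x] assms
  by (metis less_irrefl nat_neq_iff)

text \<open>Two consecutive north steps carry adjacent entries of \<open>l\<close>, so the label
  condition can fail only at a descent, and an east step in between is what prevents this.
  \<open>Suc k\<close> is the 1-based number of the north step labelled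
  \<open>l ! k\<close>.\<close>

lemma parking_function_iff_descents:
  assumes l: "l \<in> permutations_of_set {1..n}"
  shows "parking_function n (w, l) \<longleftrightarrow> dyck_path n w \<and>
    (\<forall>k. Suc k < n \<and> l ! Suc k < l ! k \<longrightarrow> north_followed_by_east (Suc k) w)"
proof -
  have len: "length l = n" and dist: "distinct l"
    using l length_finite_permutations_of_set[OF l] by (auto dest: permutations_of_setD)
  show ?thesis
  proof (intro iffI conjI allI impI; (elim conjE)?)
    assume "parking_function n (w, l)"
    then show "dyck_path n w" by (simp add: parking_function_def)
  next
    fix k
    assume p: "parking_function n (w, l)" and k: "Suc k < n" "l ! Suc k < l ! k"
    have cN: "count_list w North = n" using p by (simp add: parking_function_def dyck_path_def)
    obtain i where i: "i < length w" "w ! i = North" "count_list (take i w) North = k"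
      using ex_nth_occurrence[of k w North] k cN by auto
    \<comment> \<open>A path ending at position \<open>i\<close> would have only
      \<open>Suc k < n\<close> north steps.\<close>
    have "Suc i < length w"
    proof (rule ccontr)
      assume "\<not> Suc i < length w"
      then have "take (Suc i) w = w" by simp
      then show False using count_list_take_Suc[of i w North] i k cN by simp
    qed
    moreover have "w ! Suc i \<noteq> North"
    proof
      assume "w ! Suc i = North"
      then have "label_at (w, l) i < label_at (w, l) (Suc i)"
        using p i \<open>Suc i < length w\<close> by (simp add: parking_function_def)
      then show False using i k by (simp add: label_at_def count_list_take_Suc)
    qed
    ultimately show "north_followed_by_east (Suc k) w"
      unfolding north_followed_by_east_def using i
      by (intro exI[of _ i]) (metis (full_types) count_list_take_Suc step.exhaust Suc_eq_plus1)
  next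
    assume d: "dyck_path n w"
      and east: "\<forall>k. Suc k < n \<and> l ! Suc k < l ! k \<longrightarrow> north_followed_by_east (Suc k) w"
    have "label_at (w, l) i < label_at (w, l) (Suc i)"
      if i: "Suc i < length w" "w ! i = North" "w ! Suc i = North" for i
    proof (rule ccontr)
      define k where "k = count_list (take i w) North"
      assume "\<not> label_at (w, l) i < label_at (w, l) (Suc i)"
      then have "l ! Suc k \<le> l ! k"
        using i by (simp add: label_at_def count_list_take_Suc k_def)
      moreover have "Suc k < n"
        using occurrence_count_less[of "Suc i" "length w" w North] i d
        by (simp add: dyck_path_def k_def count_list_take_Suc)
      moreover have "l ! Suc k \<noteq> l ! k"
        using dist len \<open>Suc k < n\<close> by (simp add: nth_eq_iff_index_eq)
      ultimately obtain j where j: "Suc j < length w" "w ! j = North" "w ! Suc j = East"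
          "count_list (take (Suc j) w) North = Suc k"
        using east unfolding north_followed_by_east_def by (meson le_neq_implies_less)
      \<comment> \<open>Both are the position of the north step labelled \<open>l ! k\<close>, yet
        one is followed by a north step and the other by an east step.\<close>
      have "i = j"
        by (rule occurrence_unique[of _ w North])
          (use i j in \<open>auto simp: count_list_take_Suc k_def\<close>)
      then show False using i j by simp
    qed
    then show "parking_function n (w, l)"
      using d l by (simp add: parking_function_def)
  qed
qed

section \<open>Permutations avoiding 213 and 321\<close>

lemma contains_length_3:
  "contains l [x, y, z] \<longleftrightarrow>
    (\<exists>i j k. i < j \<and> j < k \<and> k < length l \<and>
       (l ! i \<le> l ! j \<longleftrightarrow> x \<le> y) \<and> (l ! j \<le> l ! i \<longleftrightarrow> y \<le> x) \<and>
       (l ! i \<le> l ! k \<longleftrightarrow> x \<le> z) \<and> (l ! k \<le> l ! i \<longleftrightarrow> z \<le> x) \<and>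
       (l ! j \<le> l ! k \<longleftrightarrow> y \<le> z) \<and> (l ! k \<le> l ! j \<longleftrightarrow> z \<le> y))"
  (is "_ \<longleftrightarrow> (\<exists>i j k. ?P i j k)")
proof
  assume "contains l [x, y, z]"
  then obtain f where "strict_mono_on {..<3::nat} f" "f ` {..<3} \<subseteq> {..<length l}"
    "\<forall>a<3. \<forall>b<3. l ! f a \<le> l ! f b \<longleftrightarrow> [x, y, z] ! a \<le> [x, y, z] ! b"
    by (auto simp: contains_def eval_nat_numeral)
  then have "?P (f 0) (f 1) (f 2)"
    by (auto simp: strict_mono_on_def eval_nat_numeral All_less_Suc image_subset_iff)
  then show "\<exists>i j k. ?P i j k" by blast
next
  assume "\<exists>i j k. ?P i j k"
  then obtain i j k where "?P i j k" by blast
  then show "contains l [x, y, z]"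
    unfolding contains_def
    by (intro exI[of _ "\<lambda>a. [i, j, k] ! a"])
      (auto simp: strict_mono_on_def less_Suc_eq eval_nat_numeral)
qed

lemma contains_213: "contains l [2, 1, 3] \<longleftrightarrow>
    (\<exists>i j k. i < j \<and> j < k \<and> k < length l \<and> l ! j < l ! i \<and> l ! i < l ! k)"
  unfolding contains_length_3 by (intro ex_cong1) auto

lemma contains_321: "contains l [3, 2, 1] \<longleftrightarrow>
    (\<exists>i j k. i < j \<and> j < k \<and> k < length l \<and> l ! k < l ! j \<and> l ! j < l ! i)"
  unfolding contains_length_3 by (intro ex_cong1) auto

section \<open>Swaps of two adjacent blocks of the identity\<close>

text \<open>For \<open>i < m < n\<close> the values are 1 to \<open>i\<close>, then
  \<open>i + n - m + 1\<close> to \<open>n\<close>, then \<open>i + 1\<close> to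
  \<open>i + n - m\<close>. The descent follows the first \<open>m\<close> entries, of which the
  first \<open>i\<close> are fixed.\<close>

definition block_swap :: "nat \<Rightarrow> nat \<Rightarrow> nat \<Rightarrow> nat list" where
  "block_swap n m i =
     map (\<lambda>j. if j < i then j + 1 else if j < m then j + 1 + (n - m) else j + 1 - (m - i)) [0..<n]"

lemma length_block_swap [simp]: "length (block_swap n m i) = n"
  by (simp add: block_swap_def)

lemma nth_block_swap: "j < n \<Longrightarrow> block_swap n m i ! j =
    (if j < i then j + 1 else if j < m then j + 1 + (n - m) else j + 1 - (m - i))"
  by (simp add: block_swap_def)

lemma block_swap_permutation:
  assumes "i < m" "m < n"
  shows "block_swap n m i \<in> permutations_of_set {1..n}"
proof (rule permutations_of_setI)
  show d: "distinct (block_swap n m i)"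
    unfolding distinct_conv_nth using assms by (auto simp: nth_block_swap)
  have "set (block_swap n m i) \<subseteq> {1..n}"
    using assms by (auto simp: block_swap_def)
  then show "set (block_swap n m i) = {1..n}"
    using distinct_card[OF d] by (intro card_subset_eq) auto
qed

text \<open>Every inversion joins a position in \<open>{i..<m}\<close> to one in
  \<open>{m..<n}\<close>. Hence inversions cannot be chained to a 321, and all entries after the
  lower one stay below the upper one, which excludes 213.\<close>

lemma block_swap_avoids:
  assumes "i < m" "m < n"
  shows "avoids (block_swap n m i) [2, 1, 3]" "avoids (block_swap n m i) [3, 2, 1]"
  unfolding contains_213 contains_321 using assms by (auto simp: nth_block_swap split: if_splits)

lemma block_swap_descent_iff:
  assumes "i < m" "m < n" "Suc k < n"
  shows "block_swap n m i ! Suc k < block_swap n m i ! k \<longleftrightarrow> Suc k = m"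
  using assms by (auto simp: nth_block_swap)

text \<open>The unique descent reveals \<open>m\<close>, and the entry just after it is
  \<open>i + 1\<close>.\<close>

lemma block_swap_inj:
  assumes "i < m" "m < n" "i' < m'" "m' < n" "block_swap n m i = block_swap n m' i'"
  shows "m = m' \<and> i = i'"
proof -
  have "m = m'"
    using block_swap_descent_iff[of i m n "m - 1"] block_swap_descent_iff[of i' m' n "m - 1"] assms by auto
  moreover have "block_swap n m i ! m = block_swap n m' i' ! m"
    using assms by simp
  ultimately show ?thesis using assms by (simp add: nth_block_swap)
qed

text \<open>The entries from position \<open>m\<close> on fit, in increasing order, into one gap of
  values between the earlier entries, which increase too. Moving them into that gap sorts the list;
  undoing the move gives the block swap.\<close>

lemma avoider_with_descent:
  assumes l: "l \<in> permutations_of_set {1..n}"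
    and "avoids l [2, 1, 3]" "avoids l [3, 2, 1]"
    and m: "0 < m" "m < n" and desc: "l ! m < l ! (m - 1)"
  shows "\<exists>i < m. l = block_swap n m i"
proof -
  have len: "length l = n" and dist: "distinct l" and set: "set l = {1..n}"
    using l length_finite_permutations_of_set[OF l] by (auto dest: permutations_of_setD)
  have no213: False if "i < j" "j < k" "k < n" "l ! j < l ! i" "l ! i < l ! k" for i j k
    using that assms(2) len unfolding contains_213 by blast
  have no321: False if "i < j" "j < k" "k < n" "l ! k < l ! j" "l ! j < l ! i" for i j k
    using that assms(3) len unfolding contains_321 by blast
  have neq: "l ! i \<noteq> l ! j" if "i < n" "j < n" "i \<noteq> j" for i j
    using that dist len by (simp add: nth_eq_iff_index_eq)
  have below: "l ! j < l ! (m - 1)" if "m \<le> j" "j < n" for j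
    using that no213[of "m - 1" m j] neq[of j "m - 1"] m desc by (cases "j = m") force+
  have right_inc: "l ! j < l ! k" if "m \<le> j" "j < k" "k < n" for j k
    using that no321[of "m - 1" j k] below[of j] neq[of j k] m by force
  have left_inc: "l ! j < l ! k" if "j < k" "k < m" for j k
  proof (rule ccontr)
    assume "\<not> l ! j < l ! k"
    then have kj: "l ! k < l ! j" using neq[of j k] that m by (auto simp: nat_neq_iff)
    have "l ! j \<noteq> l ! (m - 1)" using neq[of j "m - 1"] that m by auto
    \<comment> \<open>The entry at \<open>m - 1\<close> either completes the inversion at
      \<open>j\<close>, \<open>k\<close> to a 213, or lies below \<open>l ! j\<close> and forms a
      321 with \<open>l ! j\<close> and \<open>l ! m\<close>.\<close>
    then consider "l ! j < l ! (m - 1)" | "l ! (m - 1) < l ! j" by linarith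
    then show False
    proof cases
      case 1
      then have "k \<noteq> m - 1" using kj by auto
      then show False using no213[of j k "m - 1"] 1 kj that m by force
    next
      case 2
      then show False using no321[of j "m - 1" m] desc that m by force
    qed
  qed
  \<comment> \<open>The gap opens at position \<open>i\<close>. The search is unbounded, but
    \<open>m - 1\<close> qualifies, so \<open>i < m\<close>.\<close>
  define i where "i = (LEAST j. l ! m < l ! j)"
  have i: "l ! m < l ! i" and least: "\<And>j. l ! m < l ! j \<Longrightarrow> i \<le> j"
    using LeastI[of "\<lambda>j. l ! m < l ! j", OF desc] Least_le[of "\<lambda>j. l ! m < l ! j"]
    by (auto simp: i_def)
  have im: "i < m" using least[OF desc] m by auto
  \<comment> \<open>By minimality of \<open>i\<close>, \<open>l ! j\<close> does not exceed
    \<open>l ! m\<close>, the least entry from position \<open>m\<close> on.\<close>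
  have low: "l ! j < l ! k" if "j < i" "m \<le> k" "k < n" for j k
    using least[of j] neq[of j m] right_inc[of m k] that im m
    by (metis leI le_neq_implies_less less_le_trans less_trans not_less_iff_gr_or_eq)
  \<comment> \<open>Otherwise positions \<open>j\<close>, \<open>m\<close>, \<open>k\<close> would
    form a 213.\<close>
  have high: "l ! k < l ! j" if "i \<le> j" "j < m" "m \<le> k" "k < n" for j k
  proof (rule ccontr)
    assume "\<not> l ! k < l ! j"
    then have "l ! j < l ! k" using neq[of j k] that by (auto simp: nat_neq_iff)
    moreover have "l ! m < l ! j" using i left_inc[of i j] that by (cases "i = j") auto
    ultimately show False using no213[of j m k] that by (cases "k = m") auto
  qed
  \<comment> \<open>The swap is undone: an increasing list with entries 1 to \<open>n\<close> must
    be the identity.\<close>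
  define L where "L = take i l @ drop m l @ drop i (take m l)"
  have lenL: "length L = n" using len im m by (simp add: L_def)
  have nthL: "L ! j = (if j < i then l ! j else if j < i + (n - m) then l ! (j + (m - i)) else l ! (j - (n - m)))"
    if "j < n" for j
    using that len im m by (auto simp: L_def nth_append add.commute)
  have "sorted_wrt (<) L"
    unfolding sorted_wrt_iff_nth_less lenL
  proof (intro allI impI)
    fix a b
    assume ab: "a < b" "b < n"
    \<comment> \<open>The cases record which of the three blocks of \<open>L\<close>, of lengths
      \<open>i\<close>, \<open>n - m\<close> and \<open>m - i\<close>, contain \<open>a\<close> and
      \<open>b\<close>.\<close>
    consider "b < i" | "a < i" "i \<le> b" "b < i + (n - m)" | "a < i" "i + (n - m) \<le> b"
      | "i \<le> a" "b < i + (n - m)" | "i \<le> a" "a < i + (n - m)" "i + (n - m) \<le> b" | "i + (n - m) \<le> a"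
      by linarith
    then show "L ! a < L ! b"
    proof cases
      case 1
      then show ?thesis using left_inc[of a b] ab im by (simp add: nthL)
    next
      case 2
      then show ?thesis using low[of a "b + (m - i)"] ab im m by (auto simp: nthL)
    next
      case 3
      then show ?thesis using left_inc[of a "b - (n - m)"] ab im m by (auto simp: nthL)
    next
      case 4
      then show ?thesis using right_inc[of "a + (m - i)" "b + (m - i)"] ab im m by (auto simp: nthL)
    next
      case 5
      then show ?thesis using high[of "b - (n - m)" "a + (m - i)"] ab im m by (auto simp: nthL)
    next
      case 6
      then show ?thesis using left_inc[of "a - (n - m)" "b - (n - m)"] ab im m by (auto simp: nthL)
    qed
  qed
  moreover have "set L = {1..n}"
  proof -
    have "set L = set (take i l @ drop i (take m l) @ drop m l)" by (auto simp: L_def)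
    also have "take i l @ drop i (take m l) @ drop m l = l"
      using im by (metis append_take_drop_id append_assoc min.absorb1 less_imp_le take_take)
    finally show ?thesis using set by simp
  qed
  ultimately have L: "L = [1..<Suc n]"
    by (intro strict_sorted_equal) (auto simp del: upt_Suc)
  have "l = block_swap n m i"
  proof (rule nth_equalityI)
    fix j
    assume "j < length l"
    then have j: "j < n" using len by simp
    \<comment> \<open>This is the position in \<open>L\<close> of the entry \<open>l ! j\<close>,
      whose value is therefore \<open>Suc j'\<close>.\<close>
    define j' where "j' = (if j < i then j else if j < m then j + (n - m) else j - (m - i))"
    have "j' < n" using j im m by (auto simp: j'_def)
    then have "L ! j' = Suc j'" unfolding L by (simp del: upt_Suc)
    moreover have "L ! j' = l ! j"
      using j im m \<open>j' < n\<close> by (auto simp: nthL j'_def)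
    ultimately show "l ! j = block_swap n m i ! j"
      using j im m by (auto simp: nth_block_swap j'_def)
  qed (simp add: len)
  then show ?thesis using im by blast
qed

lemma permutation_without_descent:
  assumes l: "l \<in> permutations_of_set {1..n}" and "\<And>k. Suc k < n \<Longrightarrow> \<not> l ! Suc k < l ! k"
  shows "l = [1..<Suc n]"
proof (rule sorted_distinct_set_unique)
  show "sorted l"
    using assms(2) length_finite_permutations_of_set[OF l] by (simp add: sorted_iff_nth_Suc not_less)
qed (use l in \<open>auto dest: permutations_of_setD simp del: upt_Suc\<close>)

lemma identity_permutation: "[1..<Suc n] \<in> permutations_of_set {1..n}"
  by (rule permutations_of_setI) (auto simp del: upt_Suc)

lemma identity_avoids: "avoids [1..<Suc n] [2, 1, 3]" "avoids [1..<Suc n] [3, 2, 1]"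
  unfolding contains_213 contains_321 by (auto simp del: upt_Suc)

lemma avoiders_213_321:
  "{l \<in> permutations_of_set {1..n}. avoids l [2, 1, 3] \<and> avoids l [3, 2, 1]} =
     insert [1..<Suc n] ((\<lambda>(m, i). block_swap n m i) ` (SIGMA m:{1..n - 1}. {..<m}))"
  (is "?A = ?B")
proof
  show "?A \<subseteq> ?B"
  proof
    fix l
    assume l: "l \<in> ?A"
    show "l \<in> ?B"
    proof (cases "\<exists>k. Suc k < n \<and> l ! Suc k < l ! k")
      case True
      then obtain k where k: "Suc k < n" "l ! Suc k < l ! k" by blast
      then obtain i where "i < Suc k" "l = block_swap n (Suc k) i"
        using avoider_with_descent[of l n "Suc k"] l by auto
      then show ?thesis using k by (auto simp: image_iff intro!: bexI[of _ "(Suc k, i)"])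
    next
      case False
      then show ?thesis using permutation_without_descent[of l n] l by blast
    qed
  qed
next
  show "?B \<subseteq> ?A"
    using identity_permutation identity_avoids block_swap_permutation block_swap_avoids by auto
qed

section \<open>Summation over the label lists\<close>

text \<open>Labelled paths are fibred over their label list, which is their image under
  \<open>\<phi>\<close>; \<open>prod.swap\<close> moves that list to the front as the index of the
  dependent product.\<close>

lemma pf_eq_sum:
  "pf n R = (\<Sum>l | l \<in> permutations_of_set {1..n} \<and> (\<forall>\<rho>\<in>R. avoids l \<rho>).
     card {w. parking_function n (w, l)})"
  (is "_ = sum _ ?A")
proof -
  have fin: "finite ?A" by simp
  have "{p. parking_function n p \<and> (\<forall>\<rho>\<in>R. avoids (\<phi> p) \<rho>)} =
      prod.swap ` (SIGMA l:?A. {w. parking_function n (w, l)})"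
    by (auto simp: \<phi>_def parking_function_def image_iff)
  then have "pf n R = card (SIGMA l:?A. {w. parking_function n (w, l)})"
    unfolding pf_def by (simp add: card_image inj_on_def)
  also have "\<dots> = (\<Sum>l\<in>?A. card {w. parking_function n (w, l)})"
  proof (rule card_SigmaI[OF fin], rule ballI)
    fix l
    show "finite {w. parking_function n (w, l)}"
      by (rule finite_subset[OF _ finite_ballot_paths[of n n]])
        (auto simp: parking_function_def dyck_path_iff_ballot_paths)
  qed
  finally show ?thesis .
qed

theorem theorem25:
  fixes n :: nat
  assumes "n \<ge> 1"
  shows "real (pf n {[2, 1, 3], [3, 2, 1]}) = catalan n + (\<Sum>m = 1..n - 1. real m * real (h n m))"
proof -
  define S where "S = (SIGMA m:{1..n - 1}. {..<m})"
  define c where "c = (\<lambda>l. card {w. parking_function n (w, l)})"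
  have S: "i < m \<and> m < n" if "(m, i) \<in> S" for m i
    using that assms by (auto simp: S_def)
  have inj: "inj_on (\<lambda>(m, i). block_swap n m i) S"
  proof (rule inj_onI, clarify)
    fix m i m' i'
    assume "(m, i) \<in> S" "(m', i') \<in> S" "block_swap n m i = block_swap n m' i'"
    then show "m = m' \<and> i = i'" using S block_swap_inj by blast
  qed
  \<comment> \<open>A block swap has a descent, the identity has none.\<close>
  have notin: "[1..<Suc n] \<notin> (\<lambda>(m, i). block_swap n m i) ` S"
  proof
    assume "[1..<Suc n] \<in> (\<lambda>(m, i). block_swap n m i) ` S"
    then obtain m i where mi: "(m, i) \<in> S" "[1..<Suc n] = block_swap n m i" by auto
    then show False
      using block_swap_descent_iff[of i m n "m - 1"] S[OF mi(1)] unfolding mi(2)[symmetric]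
      by (simp del: upt_Suc)
  qed
  have c_id: "c [1..<Suc n] = card {w. dyck_path n w}"
  proof -
    have "\<not> [1..<Suc n] ! Suc k < [1..<Suc n] ! k" if "Suc k < n" for k
      using that by (simp del: upt_Suc)
    then show ?thesis
      unfolding c_def parking_function_iff_descents[OF identity_permutation] by meson
  qed
  have c_swap: "c (block_swap n m i) = h n m" if "(m, i) \<in> S" for m i
  proof -
    note mi = S[OF that, THEN conjunct1] S[OF that, THEN conjunct2]
    \<comment> \<open>Only \<open>k = m - 1\<close> gives a descent; it exists because
      \<open>i < m\<close> makes \<open>m\<close> positive.\<close>
    have "(\<forall>k. Suc k < n \<and> block_swap n m i ! Suc k < block_swap n m i ! k
        \<longrightarrow> north_followed_by_east (Suc k) w) \<longleftrightarrow> north_followed_by_east m w" for w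
      using block_swap_descent_iff[OF mi] mi by (metis Suc_pred bot_nat_0.not_eq_extremum not_less0)
    then show ?thesis
      unfolding c_def h_def parking_function_iff_descents[OF block_swap_permutation[OF mi]] by simp
  qed
  have finS: "finite S" by (simp add: S_def)
  have "pf n {[2, 1, 3], [3, 2, 1]} = sum c (insert [1..<Suc n] ((\<lambda>(m, i). block_swap n m i) ` S))"
    unfolding pf_eq_sum S_def c_def using avoiders_213_321[of n] by simp
  also have "\<dots> = card {w. dyck_path n w} + (\<Sum>(m, i)\<in>S. c (block_swap n m i))"
    using notin finS c_id sum.reindex[OF inj, of c]
    by (simp add: case_prod_unfold comp_def del: upt_Suc One_nat_def)
  also have "(\<Sum>(m, i)\<in>S. c (block_swap n m i)) = (\<Sum>(m, i)\<in>S. h n m)"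
    by (intro sum.cong) (auto simp: c_swap)
  \<comment> \<open>The summand is constant in \<open>i\<close>, which takes \<open>m\<close>
    values.\<close>
  also have "\<dots> = (\<Sum>m = 1..n - 1. m * h n m)"
    unfolding S_def by (subst sum.Sigma[symmetric]) auto
  finally show ?thesis by (simp add: card_dyck_paths)
qed

end
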